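(* There is an absolute constant $C>0$ such that the following holds. Let $d\ge 2$, $p\in[1,\infty]$, $\epsilon\in(0,1/2]$, and let $A$ be a nonzero real symmetric $d\times d$ matrix having an eigenvalue $\lambda_{\min}$ with $\lambda_{\min}\le-\epsilon\|A\|_p$. Let $g\sim\mathcal{N}(0,I_d)$ and let $\mathcal{K}_k(g)=\mathrm{span}(g,Ag,A^2g,\ldots,A^kg)$. Then, with probability at least $2/3$ over $g$, the Krylov subspace $\mathcal{K}_k(g)$ contains a vector $v$ with $v^TAv<0$, provided (i) if $p=1$: $k\ge C\left(\frac1\epsilon\right)^{1/3}\log\frac1\epsilon$; (ii) if $p\in(1,\infty]$: $k\ge C\left(\frac1\epsilon\right)^{\frac{p}{2p+1}}\log\frac1\epsilon\,\log d$ (where $\frac{p}{2p+1}=\frac12$ for $p=\infty$).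
   Context: $\|A\|_p$ denotes the Schatten-$p$ norm of $A$, i.e. the $\ell_p$ norm of its vector of singular values ($\|A\|_\infty$ is the operator norm). *)

theory Defs
  imports
    "HOL-Probability.Probability"
    "Jordan_Normal_Form.Char_Poly"
    "Jordan_Normal_Form.VS_Connect"
begin

text \<open>Matrices and vectors have explicit dimensions (\<^typ>\<open>real mat\<close>, \<^typ>\<open>real vec\<close>) rather than
  type-indexed ones, so that a constant can be chosen uniformly in the dimension.\<close>

text \<open>\<^const>\<open>proots\<close> counts roots with multiplicity, and the characteristic polynomial of
  \<open>A\<^sup>T A\<close> splits over the reals with nonnegative roots, so for a square matrix of dimension
  \<open>d\<close> this multiset has exactly \<open>d\<close> elements.\<close>

definition singular_values :: "real mat \<Rightarrow> real multiset" where
  "singular_values A = image_mset sqrt (proots (char_poly (transpose_mat A * A)))"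

text \<open>Only used for \<open>p \<in> [1, \<infinity>]\<close> and nonempty multisets. Note that \<open>0 powr p = 0\<close>.\<close>

definition lp_norm :: "ereal \<Rightarrow> real multiset \<Rightarrow> real" where
  "lp_norm p M =
     (if p = \<infinity> then Max (abs ` set_mset M)
      else (\<Sum>x\<in>#M. \<bar>x\<bar> powr real_of_ereal p) powr (1 / real_of_ereal p))"

definition schatten_norm :: "ereal \<Rightarrow> real mat \<Rightarrow> real" where
  "schatten_norm p A = lp_norm p (singular_values A)"

text \<open>The law of the coordinates of \<open>g \<sim> N(0, I\<^sub>d)\<close>, as a measure on functions on \<open>{..<d}\<close>;
  the vector itself is \<^term>\<open>vec d g\<close>.\<close>

definition std_gaussian :: "nat \<Rightarrow> (nat \<Rightarrow> real) measure" where
  "std_gaussian d = Pi\<^sub>M {..<d} (\<lambda>_. density lborel std_normal_density)"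

definition krylov :: "real mat \<Rightarrow> real vec \<Rightarrow> nat \<Rightarrow> real vec set" where
  "krylov A g k =
     LinearCombinations.module.span class_ring (module_vec TYPE(real) (dim_vec g))
       ((\<lambda>i. (A ^\<^sub>m i) *\<^sub>v g) ` {..k})"

text \<open>The value of \<open>p / (2p + 1)\<close>, extended to \<open>p = \<infinity>\<close> by its limit.\<close>

definition krylov_exponent :: "ereal \<Rightarrow> real" where
  "krylov_exponent p =
     (if p = \<infinity> then 1 / 2 else real_of_ereal p / (2 * real_of_ereal p + 1))"

end

theory Submission
  imports
    Defs
    "Jordan_Normal_Form.Schur_Decomposition"
    "Jordan_Normal_Form.Spectral_Radius"
begin

text \<open>In an orthonormal eigenbasis \<open>u\<^sub>i\<close> of \<open>A\<close> with eigenvalues \<open>l\<^sub>i\<close>, the vector \<open>v = q(A) g\<close>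
  satisfies \<open>v\<^sup>T A v = \<Sum> l\<^sub>i q(l\<^sub>i)\<^sup>2 \<langle>u\<^sub>i, g\<rangle>\<^sup>2\<close>, where each \<open>\<langle>u\<^sub>i, g\<rangle>\<close> is standard normal. By
  Markov's inequality for the positive eigenvalues and anticoncentration for the given negative
  one, \<open>l\<^sub>j\<close>, it suffices to find \<open>q\<close> of degree at most \<open>k\<close> such that \<open>S = \<Sum> l\<^sub>i q(l\<^sub>i)\<^sup>2\<close> over the
  positive eigenvalues is a small multiple of \<open>\<bar>l\<^sub>j\<bar> q(l\<^sub>j)\<^sup>2\<close>.

  Normalise \<open>A\<close> to Schatten norm \<open>1\<close>. At most \<open>1 / t\<^sup>p\<close> eigenvalues exceed a threshold \<open>t\<close>, and \<open>q\<close>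
  is made to vanish at each of them. The other factor of \<open>q\<close> is a Chebyshev polynomial for
  \<open>[0, t]\<close>, which grows like \<open>exp (m \<surd>(\<epsilon>/t))\<close> in its degree \<open>m\<close> at \<open>-\<epsilon>\<close>. The choice
  \<open>t = \<epsilon> powr (1 / (2p + 1))\<close> makes \<open>1 / t\<^sup>p\<close> and \<open>\<surd>(t/\<epsilon>)\<close> equal. The remaining eigenvalues
  contribute at most \<open>d\<close> to \<open>S\<close>, which costs the factor \<open>log d\<close>; for \<open>p = 1\<close> they contribute at
  most \<open>1\<close>.\<close>

unbundle no inner_syntax

subsection \<open>Diagonalization of real symmetric matrices\<close>

lemma symmetric_scalar_prod_mult:
  fixes A :: "'a :: comm_semiring_0 mat"
  assumes "A \<in> carrier_mat n n" "transpose_mat A = A" "x \<in> carrier_vec n" "y \<in> carrier_vec n"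
  shows "x \<bullet> (A *\<^sub>v y) = (A *\<^sub>v x) \<bullet> y"
  using transpose_vec_mult_scalar[of A n n y x] assms by simp

text \<open>Over the complex numbers an eigenvector \<open>z = x + i y\<close> with eigenvalue
  \<open>c\<close> exists. Symmetry equates \<open>x \<bullet> (A *\<^sub>v y)\<close> with
  \<open>y \<bullet> (A *\<^sub>v x)\<close>, which forces
  \<open>Im c * (x \<bullet> x + y \<bullet> y) = 0\<close>. So \<open>c\<close> is real, and
  whichever of \<open>x\<close> and \<open>y\<close> is nonzero is a real eigenvector.\<close>

lemma real_symmetric_eigenvalue_exists:
  fixes A :: "real mat"
  assumes A: "A \<in> carrier_mat n n" and sym: "transpose_mat A = A" and n: "n > 0"
  shows "\<exists>e. eigenvalue A e"
proof -
  let ?B = "map_mat complex_of_real A"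
  have B: "?B \<in> carrier_mat n n" using A by simp
  from spectrum_non_empty[OF B n] obtain c where "eigenvalue ?B c"
    unfolding spectrum_def by auto
  then obtain z where z: "z \<in> carrier_vec n" "z \<noteq> 0\<^sub>v n" "?B *\<^sub>v z = c \<cdot>\<^sub>v z"
    unfolding eigenvalue_def eigenvector_def using A by auto
  define x where "x = map_vec Re z"
  define y where "y = map_vec Im z"
  have x: "x \<in> carrier_vec n" and y: "y \<in> carrier_vec n" using z by (auto simp: x_def y_def)
  have comp: "(\<Sum>j<n. complex_of_real (A $$ (i,j)) * z $ j) = c * z $ i" if "i < n" for i
    using arg_cong[OF z(3), of "\<lambda>v. v $ i"] that A z(1)
    by (simp add: scalar_prod_def lessThan_atLeast0)
  have Ax: "A *\<^sub>v x = Re c \<cdot>\<^sub>v x - Im c \<cdot>\<^sub>v y"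
  proof (rule eq_vecI)
    fix i assume "i < dim_vec (Re c \<cdot>\<^sub>v x - Im c \<cdot>\<^sub>v y)"
    hence i: "i < n" using y by simp
    show "(A *\<^sub>v x) $ i = (Re c \<cdot>\<^sub>v x - Im c \<cdot>\<^sub>v y) $ i"
      using arg_cong[OF comp[OF i], of Re] i A z(1)
      by (simp add: scalar_prod_def lessThan_atLeast0 x_def y_def)
  qed (use A y in simp)
  have Ay: "A *\<^sub>v y = Im c \<cdot>\<^sub>v x + Re c \<cdot>\<^sub>v y"
  proof (rule eq_vecI)
    fix i assume "i < dim_vec (Im c \<cdot>\<^sub>v x + Re c \<cdot>\<^sub>v y)"
    hence i: "i < n" using y by simp
    show "(A *\<^sub>v y) $ i = (Im c \<cdot>\<^sub>v x + Re c \<cdot>\<^sub>v y) $ i"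
      using arg_cong[OF comp[OF i], of Im] i A z(1)
      by (simp add: scalar_prod_def lessThan_atLeast0 x_def y_def)
  qed (use A y in simp)
  have xy: "x \<bullet> y = y \<bullet> x" by (rule comm_scalar_prod[OF x y])
  have "x \<bullet> (A *\<^sub>v y) = y \<bullet> (A *\<^sub>v x)"
    using symmetric_scalar_prod_mult[OF A sym x y] comm_scalar_prod[OF y, of "A *\<^sub>v x"] A x by simp
  hence "Im c * (x \<bullet> x) + Re c * (x \<bullet> y) = Re c * (x \<bullet> y) - Im c * (y \<bullet> y)"
    unfolding Ax Ay using x y xy
    by (simp add: scalar_prod_add_distrib[of _ n] scalar_prod_minus_distrib[of _ n])
  hence "Im c * (x \<bullet> x + y \<bullet> y) = 0" by (simp add: algebra_simps)
  moreover have "x \<bullet> x + y \<bullet> y \<noteq> 0"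
  proof
    assume *: "x \<bullet> x + y \<bullet> y = 0"
    have "x \<bullet> x \<ge> 0" "y \<bullet> y \<ge> 0" by (auto simp: scalar_prod_def intro!: sum_nonneg)
    with * have "x \<bullet> x = 0" "y \<bullet> y = 0" by linarith+
    hence "x = 0\<^sub>v n" "y = 0\<^sub>v n"
      using conjugate_square_eq_0_vec[OF x] conjugate_square_eq_0_vec[OF y] by simp_all
    hence "map_vec Re z $ i = 0 \<and> map_vec Im z $ i = 0" if "i < n" for i
      using that unfolding x_def y_def by simp
    hence "z = 0\<^sub>v n" using z(1) by (intro eq_vecI) (auto simp: complex_eq_iff)
    thus False using z by simp
  qed
  ultimately have im: "Im c = 0" by simp
  have "\<exists>v. v \<in> carrier_vec n \<and> v \<noteq> 0\<^sub>v n \<and> A *\<^sub>v v = Re c \<cdot>\<^sub>v v"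
  proof (cases "x = 0\<^sub>v n")
    case True
    have "y \<noteq> 0\<^sub>v n" using \<open>x \<bullet> x + y \<bullet> y \<noteq> 0\<close> True by auto
    moreover have "A *\<^sub>v y = Re c \<cdot>\<^sub>v y" using Ay im x y by (intro eq_vecI) auto
    ultimately show ?thesis using y by blast
  next
    case False
    moreover have "A *\<^sub>v x = Re c \<cdot>\<^sub>v x" using Ax im x y by (intro eq_vecI) auto
    ultimately show ?thesis using x by blast
  qed
  thus ?thesis unfolding eigenvalue_def eigenvector_def using A by auto
qed

text \<open>Complete \<open>v\<close> to a basis, apply Gram-Schmidt, which leaves the first vector
  unchanged, and normalise the columns. This is the change of basis that splits off one eigenvector
  in the diagonalization.\<close>

lemma orthogonal_mat_with_first_col:
  fixes v :: "real vec"
  assumes v: "v \<in> carrier_vec n" "v \<noteq> 0\<^sub>v n"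
  shows "\<exists>W c. W \<in> carrier_mat n n \<and> transpose_mat W * W = 1\<^sub>m n \<and> col W 0 = c \<cdot>\<^sub>v v"
proof -
  interpret cof_vec_space n "TYPE(real)" .
  define ws where "ws = gram_schmidt n (basis_completion v)"
  note b = basis_completion[OF v]
  from gram_schmidt_result[OF b(2,4,5) refl] b(6)
  have ws: "set ws \<subseteq> carrier_vec n" "corthogonal ws" "length ws = n" by (auto simp: ws_def)
  have hd: "hd ws = v" using gram_schmidt_hd[OF v(1)]
    unfolding ws_def basis_completion_def Let_def by auto
  have n: "n > 0" using v by (cases n) auto
  have ws0: "ws ! 0 = v" using hd ws n by (simp add: hd_conv_nth[symmetric] flip: length_greater_0_conv)
  have wsi: "ws ! i \<in> carrier_vec n" if "i < n" for i using ws that by auto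
  \<comment> \<open>The case \<open>i = j\<close> says that every \<open>ws ! i\<close> has nonzero
    length, so the normalising factor \<open>c\<close> below divides by a nonzero number.\<close>
  have orth: "(ws ! i \<bullet> ws ! j = 0) = (i \<noteq> j)" if "i < n" "j < n" for i j
    using corthogonalD[OF ws(2), of i j] that ws(3) by simp
  define c where "c = (\<lambda>w :: real vec. 1 / sqrt (w \<bullet> w))"
  define W where "W = mat_of_cols n (map (\<lambda>w. c w \<cdot>\<^sub>v w) ws)"
  have W: "W \<in> carrier_mat n n" unfolding W_def using ws(3) by auto
  have col: "col W i = c (ws ! i) \<cdot>\<^sub>v ws ! i" if "i < n" for i
    unfolding W_def using that ws(3) wsi[OF that] by (subst col_mat_of_cols) auto
  have "transpose_mat W * W = 1\<^sub>m n"
  proof (rule eq_matI)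
    fix i j assume "i < dim_row (1\<^sub>m n :: real mat)" "j < dim_col (1\<^sub>m n :: real mat)"
    hence i: "i < n" and j: "j < n" by auto
    have "(transpose_mat W * W) $$ (i,j) = col W i \<bullet> col W j"
      using i j W by simp
    also have "\<dots> = c (ws ! i) * (c (ws ! j) * (ws ! i \<bullet> ws ! j))"
      using wsi[OF i] wsi[OF j] by (simp add: col[OF i] col[OF j])
    also have "\<dots> = (if i = j then 1 else 0)"
    proof (cases "i = j")
      case True
      have "ws ! i \<bullet> ws ! i \<ge> 0" by (auto simp: scalar_prod_def intro!: sum_nonneg)
      moreover have "ws ! i \<bullet> ws ! i \<noteq> 0" using orth[OF i i] by simp
      ultimately show ?thesis using True by (simp add: c_def field_simps)
    next
      case False thus ?thesis using orth[OF i j] by simp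
    qed
    finally show "(transpose_mat W * W) $$ (i,j) = 1\<^sub>m n $$ (i,j)" using i j by simp
  qed (use W in auto)
  moreover have "col W 0 = c v \<cdot>\<^sub>v v" using col[OF n] ws0 by simp
  ultimately show ?thesis using W by blast
qed

text \<open>Induction on the dimension: in an orthonormal basis that starts with an eigenvector,
  \<open>A\<close> is block diagonal with a \<open>1 \<times> 1\<close> block and a symmetric block
  of dimension one less, to which the induction hypothesis applies.\<close>

theorem real_symmetric_diagonalization:
  fixes A :: "real mat"
  assumes "A \<in> carrier_mat n n" "transpose_mat A = A"
  shows "\<exists>U D. U \<in> carrier_mat n n \<and> D \<in> carrier_mat n n \<and> diagonal_mat D \<and>
    transpose_mat U * U = 1\<^sub>m n \<and> A * U = U * D"
  using assms
proof (induction n arbitrary: A)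
  case 0
  thus ?case by (intro exI[of _ "1\<^sub>m 0"]) (auto simp: diagonal_mat_def)
next
  case (Suc m A)
  let ?n = "Suc m"
  note A = Suc.prems(1) and sym = Suc.prems(2)
  obtain e v where v: "v \<in> carrier_vec ?n" "v \<noteq> 0\<^sub>v ?n" "A *\<^sub>v v = e \<cdot>\<^sub>v v"
    using real_symmetric_eigenvalue_exists[OF A sym] A unfolding eigenvalue_def eigenvector_def by auto
  from orthogonal_mat_with_first_col[OF v(1,2)] obtain W c where
    W: "W \<in> carrier_mat ?n ?n" and WW: "transpose_mat W * W = 1\<^sub>m ?n" and W0: "col W 0 = c \<cdot>\<^sub>v v"
    by blast
  have WT: "transpose_mat W \<in> carrier_mat ?n ?n" using W by simp
  have WW': "W * transpose_mat W = 1\<^sub>m ?n" by (rule mat_mult_left_right_inverse[OF WT W WW])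
  have AW0: "A *\<^sub>v col W 0 = e \<cdot>\<^sub>v col W 0"
    unfolding W0 using v A by (simp add: mult_mat_vec[of _ ?n ?n] smult_smult_assoc mult.commute)
  define A' where "A' = transpose_mat W * (A * W)"
  have A': "A' \<in> carrier_mat ?n ?n" unfolding A'_def using A W by auto
  have symA': "transpose_mat A' = A'"
    unfolding A'_def using A W sym
    by (simp add: transpose_mult[of _ ?n ?n _ ?n] assoc_mult_mat[of _ ?n ?n _ ?n _ ?n])
  \<comment> \<open>The first column of \<open>W\<close> is an eigenvector and the columns are
    orthonormal, which determines the first column of \<open>A'\<close>; symmetry then gives its
    first row.\<close>
  have A'0: "A' $$ (i,0) = (if i = 0 then e else 0)" if i: "i < ?n" for i
  proof -
    have "A' $$ (i,0) = col W i \<bullet> (A *\<^sub>v col W 0)"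
      unfolding A'_def using i A W by (simp add: mult_mat_vec_def)
    also have "\<dots> = e * (col W i \<bullet> col W 0)" unfolding AW0 using W by simp
    also have "col W i \<bullet> col W 0 = (transpose_mat W * W) $$ (i,0)" using i W by simp
    also have "\<dots> = (if i = 0 then 1 else 0)" unfolding WW using i by simp
    finally show ?thesis by simp
  qed
  have A'0': "A' $$ (0,i) = (if i = 0 then e else 0)" if i: "i < ?n" for i
    using A'0[OF i] arg_cong[OF symA', of "\<lambda>M. M $$ (i,0)"] i A' by simp
  define A3 where "A3 = mat m m (\<lambda>(i,j). A' $$ (Suc i, Suc j))"
  have A3: "A3 \<in> carrier_mat m m" "transpose_mat A3 = A3"
  proof -
    have "A' $$ (Suc j, Suc i) = A' $$ (Suc i, Suc j)" if "i < m" "j < m" for i j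
      using arg_cong[OF symA', of "\<lambda>M. M $$ (Suc i, Suc j)"] that A' by simp
    thus "A3 \<in> carrier_mat m m" "transpose_mat A3 = A3"
      by (auto simp: A3_def intro!: eq_matI)
  qed
  define E where "E = mat 1 1 (\<lambda>_. e)"
  have E: "E \<in> carrier_mat 1 1" unfolding E_def by simp
  let ?blk = "\<lambda>X Y. four_block_mat X (0\<^sub>m 1 m) (0\<^sub>m m 1) Y"
  have blk: "A' = ?blk E A3"
  proof (rule eq_matI)
    fix i j assume "i < dim_row (?blk E A3)" "j < dim_col (?blk E A3)"
    hence i: "i < ?n" and j: "j < ?n" by (auto simp: E_def A3_def)
    show "A' $$ (i,j) = ?blk E A3 $$ (i,j)"
      using i j A'0[OF i] A'0'[OF j] by (cases i; cases j) (auto simp: E_def A3_def)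
  qed (use A' in \<open>auto simp: E_def A3_def\<close>)
  from Suc.IH[OF A3] obtain V D' where V: "V \<in> carrier_mat m m" and D': "D' \<in> carrier_mat m m"
    "diagonal_mat D'" and VV: "transpose_mat V * V = 1\<^sub>m m" and AV: "A3 * V = V * D'" by blast
  define Z where "Z = ?blk (1\<^sub>m 1) V"
  define D where "D = ?blk E D'"
  have Z: "Z \<in> carrier_mat ?n ?n" unfolding Z_def using four_block_carrier_mat[of "1\<^sub>m 1" 1 1 V m m] V by simp
  have D: "D \<in> carrier_mat ?n ?n" unfolding D_def using four_block_carrier_mat[OF E D'(1)] by simp
  have "transpose_mat Z * Z = ?blk (1\<^sub>m 1) (1\<^sub>m m)"
    unfolding Z_def using V VV
    by (subst transpose_four_block_mat[of _ 1 1 _ m _ m], auto)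
       (subst mult_four_block_mat[of _ 1 1 _ m _ m _ _ 1 _ m], auto)
  also have "\<dots> = 1\<^sub>m ?n" by (rule eq_matI) auto
  finally have ZZ: "transpose_mat Z * Z = 1\<^sub>m ?n" .
  have "A' * Z = ?blk E (A3 * V)"
    unfolding blk Z_def using V E A3
    by (subst mult_four_block_mat[of _ 1 1 _ m _ m _ _ 1 _ m], auto)
  also have "\<dots> = Z * D"
    unfolding AV Z_def D_def using V E D'(1)
    by (subst mult_four_block_mat[of _ 1 1 _ m _ m _ _ 1 _ m], auto)
  finally have AZ: "A' * Z = Z * D" .
  define U where "U = W * Z"
  have U: "U \<in> carrier_mat ?n ?n" unfolding U_def using W Z by auto
  have ZT: "transpose_mat Z \<in> carrier_mat ?n ?n" using Z by simp
  have "transpose_mat U * U = transpose_mat Z * (transpose_mat W * (W * Z))"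
    unfolding U_def using W Z by (simp add: transpose_mult[of _ ?n ?n _ ?n] assoc_mult_mat[of _ ?n ?n _ ?n _ ?n])
  also have "transpose_mat W * (W * Z) = (transpose_mat W * W) * Z"
    using W Z by (simp add: assoc_mult_mat[of _ ?n ?n _ ?n _ ?n])
  finally have UU: "transpose_mat U * U = 1\<^sub>m ?n" using WW ZZ Z by simp
  have "U * D = W * (A' * Z)" unfolding AZ U_def using W Z D by (simp add: assoc_mult_mat[of _ ?n ?n _ ?n _ ?n])
  also have "\<dots> = (W * transpose_mat W) * (A * (W * Z))"
    unfolding A'_def using W Z A by (simp add: assoc_mult_mat[of _ ?n ?n _ ?n _ ?n])
  also have "\<dots> = A * U" unfolding WW' U_def using A W Z by simp
  finally have AU: "A * U = U * D" by simp
  have "diagonal_mat D" using D'(1,2) E unfolding D_def diagonal_mat_def by auto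
  thus ?case using U D UU AU by blast
qed

subsection \<open>Krylov subspaces and Schatten norms in an eigenbasis\<close>

text \<open>The columns of the matrix are the generators, so the coefficient function
  \<open>a\<close> is that of a polynomial \<open>q\<close> of degree at most \<open>k\<close> with
  \<open>v = q(A) g\<close>.\<close>

lemma mem_krylov_iff:
  assumes A: "A \<in> carrier_mat d d" and g: "g \<in> carrier_vec d"
  shows "v \<in> krylov A g k \<longleftrightarrow>
    (\<exists>a. v = mat_of_cols d (map (\<lambda>i. (A ^\<^sub>m i) *\<^sub>v g) [0..<Suc k]) *\<^sub>v vec (Suc k) a)"
proof -
  interpret vec_space "TYPE(real)" d .
  let ?vs = "map (\<lambda>i. (A ^\<^sub>m i) *\<^sub>v g) [0..<Suc k]"
  have Ai: "(A ^\<^sub>m i) *\<^sub>v g \<in> carrier_vec d" for i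
    using pow_carrier_mat[OF A, of i] g by (rule mult_mat_vec_carrier)
  hence vs: "set ?vs \<subseteq> carrier_vec d" by auto
  have lc: "lincomb_list c ?vs = mat_of_cols d ?vs *\<^sub>v vec (Suc k) c" for c
  proof -
    have dims: "\<forall>w\<in>set ?vs. dim_vec w = d" using vs carrier_vecD by blast
    from lincomb_list_as_mat_mult[OF dims, of c] show ?thesis by (simp del: upt_Suc)
  qed
  have "(\<lambda>i. (A ^\<^sub>m i) *\<^sub>v g) ` {..k} = set ?vs" by (auto simp: atMost_upto)
  hence "krylov A g k = span (set ?vs)" using g unfolding krylov_def by simp
  also have "\<dots> = span_list ?vs" using span_list_as_span[OF vs] by simp
  finally show ?thesis
    by (auto simp: span_list_def class_ring_simps lc simp del: upt_Suc)
qed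

text \<open>By symmetry each factor \<open>A\<close> moves to the side of \<open>u\<close>, where it
  acts as \<open>c\<close>. Hence \<open>q(A) g\<close> has \<open>q(c)\<close> times the coordinate
  of \<open>g\<close> along \<open>u\<close>.\<close>

lemma eigenvector_scalar_prod_pow:
  fixes A :: "'a :: comm_ring_1 mat"
  assumes A: "A \<in> carrier_mat d d" "transpose_mat A = A"
    and u: "u \<in> carrier_vec d" "A *\<^sub>v u = c \<cdot>\<^sub>v u" and g: "g \<in> carrier_vec d"
  shows "u \<bullet> ((A ^\<^sub>m i) *\<^sub>v g) = c ^ i * (u \<bullet> g)"
  using g
proof (induction i arbitrary: g)
  case 0 thus ?case using A by simp
next
  case (Suc i g)
  have Ag: "A *\<^sub>v g \<in> carrier_vec d" using A Suc.prems by auto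
  have "(A ^\<^sub>m Suc i) *\<^sub>v g = (A ^\<^sub>m i) *\<^sub>v (A *\<^sub>v g)"
    using assoc_mult_mat_vec[OF pow_carrier_mat[OF A(1)] A(1) Suc.prems] by simp
  hence "u \<bullet> ((A ^\<^sub>m Suc i) *\<^sub>v g) = c ^ i * (u \<bullet> (A *\<^sub>v g))" using Suc.IH[OF Ag] by simp
  also have "u \<bullet> (A *\<^sub>v g) = c * (u \<bullet> g)"
    using symmetric_scalar_prod_mult[OF A u(1) Suc.prems] u Suc.prems by simp
  finally show ?case by simp
qed

text \<open>Column \<open>i\<close> of \<open>U\<close> is a unit eigenvector for
  \<open>l i\<close>. Repeated eigenvalues keep separate indices, so sums over \<open>i < d\<close>
  count multiplicities just as the Schatten norm does.\<close>

locale orthogonal_diagonalization =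
  fixes A U :: "real mat" and l :: "nat \<Rightarrow> real" and d :: nat
  assumes A: "A \<in> carrier_mat d d" and sym: "transpose_mat A = A"
    and U: "U \<in> carrier_mat d d" and UU: "transpose_mat U * U = 1\<^sub>m d"
    and AU: "A * U = U * mat d d (\<lambda>(i,j). if i = j then l i else 0)"
begin

lemma col_carrier: "i < d \<Longrightarrow> col U i \<in> carrier_vec d"
  using U by auto

lemma UU': "U * transpose_mat U = 1\<^sub>m d"
  by (rule mat_mult_left_right_inverse[OF _ U UU]) (use U in simp)

text \<open>The diagonal \<open>f\<close> is arbitrary because it is \<open>l\<close> for the matrix
  \<open>A\<close> and the square of \<open>l\<close> for \<open>A * A\<close>.\<close>

lemma mult_diag:
  assumes "i < d"
  shows "U *\<^sub>v col (mat d d (\<lambda>(i,j). if i = j then f i else 0)) i = f i \<cdot>\<^sub>v col U i"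
proof (rule eq_vecI)
  fix k assume "k < dim_vec (f i \<cdot>\<^sub>v col U i)"
  hence k: "k < d" using U by simp
  have "(U *\<^sub>v col (mat d d (\<lambda>(i,j). if i = j then f i else 0)) i) $ k
      = (\<Sum>m\<in>{0..<d}. U $$ (k,m) * (if m = i then f m else 0))"
    using U k assms by (simp add: scalar_prod_def)
  also have "\<dots> = (\<Sum>m\<in>{0..<d}. if m = i then U $$ (k,m) * f m else 0)"
    by (intro sum.cong) auto
  also have "\<dots> = U $$ (k,i) * f i" using assms by simp
  finally show "(U *\<^sub>v col (mat d d (\<lambda>(i,j). if i = j then f i else 0)) i) $ k
      = (f i \<cdot>\<^sub>v col U i) $ k" using U k assms by simp
qed (use U in simp)

lemma eigen: "i < d \<Longrightarrow> A *\<^sub>v col U i = l i \<cdot>\<^sub>v col U i"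
proof -
  assume i: "i < d"
  have "A *\<^sub>v col U i = col (A * U) i" using col_mult2[OF A U i] by simp
  also have "\<dots> = U *\<^sub>v col (mat d d (\<lambda>(i,j). if i = j then l i else 0)) i"
    unfolding AU by (rule col_mult2[OF U _ i]) simp
  finally show ?thesis using mult_diag[OF i] by simp
qed

lemma norm_col: "i < d \<Longrightarrow> (\<Sum>j<d. (U $$ (j,i))\<^sup>2) = 1"
  using arg_cong[OF UU, of "\<lambda>M. M $$ (i,i)"] U
  by (simp add: scalar_prod_def power2_eq_square lessThan_atLeast0)

lemma Parseval:
  assumes x: "x \<in> carrier_vec d" and y: "y \<in> carrier_vec d"
  shows "x \<bullet> y = (\<Sum>i<d. (col U i \<bullet> x) * (col U i \<bullet> y))"
proof -
  have Ux: "transpose_mat U *\<^sub>v x \<in> carrier_vec d" "transpose_mat U *\<^sub>v y \<in> carrier_vec d"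
    using U x y by auto
  have "x \<bullet> y = x \<bullet> (U *\<^sub>v (transpose_mat U *\<^sub>v y))"
    using assoc_mult_mat_vec[of U d d "transpose_mat U" d y] U y UU' by simp
  also have "\<dots> = (transpose_mat U *\<^sub>v x) \<bullet> (transpose_mat U *\<^sub>v y)"
    using transpose_vec_mult_scalar[OF U Ux(2) x] by simp
  finally show ?thesis using U by (simp add: scalar_prod_def[of _ "transpose_mat U *\<^sub>v y"] lessThan_atLeast0)
qed

lemma quadratic_form:
  assumes v: "v \<in> carrier_vec d"
  shows "v \<bullet> (A *\<^sub>v v) = (\<Sum>i<d. l i * (col U i \<bullet> v)\<^sup>2)"
proof -
  have "col U i \<bullet> (A *\<^sub>v v) = l i * (col U i \<bullet> v)" if "i < d" for i
    using eigenvector_scalar_prod_pow[OF A sym col_carrier[OF that] eigen[OF that] v, of 1] A by simp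
  thus ?thesis using Parseval[OF v, of "A *\<^sub>v v"] A v
    by (auto simp: power2_eq_square intro!: sum.cong)
qed

text \<open>An eigenvector for \<open>e\<close> has a nonzero coordinate along some column of
  \<open>U\<close>; comparing that coordinate of \<open>A *\<^sub>v v\<close> computed in two ways
  gives \<open>l i = e\<close>.\<close>

lemma eigenvalue_index:
  assumes "eigenvalue A e"
  shows "\<exists>j<d. l j = e"
proof -
  obtain v where v: "v \<in> carrier_vec d" "v \<noteq> 0\<^sub>v d" "A *\<^sub>v v = e \<cdot>\<^sub>v v"
    using assms A by (auto simp: eigenvalue_def eigenvector_def)
  have "v \<bullet> v \<noteq> 0" using conjugate_square_eq_0_vec[OF v(1)] v(2) by simp
  then obtain i where i: "i < d" "col U i \<bullet> v \<noteq> 0"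
    using Parseval[OF v(1) v(1)] by (metis (no_types, lifting) lessThan_iff mult_zero_left sum.neutral)
  have "l i * (col U i \<bullet> v) = col U i \<bullet> (A *\<^sub>v v)"
    using eigenvector_scalar_prod_pow[OF A sym col_carrier[OF i(1)] eigen[OF i(1)] v(1), of 1] A by simp
  also have "\<dots> = e * (col U i \<bullet> v)" using v col_carrier[OF i(1)] by simp
  finally show ?thesis using i by auto
qed

lemma eigenvalues_nonzero:
  assumes "A \<noteq> 0\<^sub>m d d"
  shows "\<exists>i<d. l i \<noteq> 0"
proof (rule ccontr)
  assume "\<not> ?thesis"
  hence "A * U = U * 0\<^sub>m d d" unfolding AU by (intro arg_cong[of _ _ "(*) U"] eq_matI) auto
  hence "A * U = 0\<^sub>m d d" using U by simp
  moreover have "A = (A * U) * transpose_mat U"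
    using assoc_mult_mat[OF A U, of "transpose_mat U" d] U UU' A by simp
  ultimately have "A = 0\<^sub>m d d" using U by simp
  thus False using assms by simp
qed

text \<open>By symmetry \<open>transpose_mat A * A\<close> is \<open>A * A\<close>, which is similar
  to the diagonal matrix of the squares of the \<open>l i\<close>. Its characteristic polynomial
  therefore splits with exactly these roots, and \<open>sqrt\<close> turns them into absolute
  values.\<close>

lemma singular_values_eq:
  "singular_values A = image_mset (\<lambda>i. \<bar>l i\<bar>) (mset_set {..<d})"
proof -
  define D2 where "D2 = mat d d (\<lambda>(i,j). if i = j then (l i)\<^sup>2 else 0)"
  have D2: "D2 \<in> carrier_mat d d" by (simp add: D2_def)
  have UT: "transpose_mat U \<in> carrier_mat d d" using U by simp
  have "(A * A) * U = U * D2"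
  proof (rule mat_col_eqI)
    fix i assume "i < dim_col (U * D2)"
    hence i: "i < d" using D2 by simp
    have "col ((A * A) * U) i = A *\<^sub>v (A *\<^sub>v col U i)"
      using i A U by (subst col_mult2[of _ d d _ d]) auto
    also have "\<dots> = (l i)\<^sup>2 \<cdot>\<^sub>v col U i"
      using eigen[OF i] A col_carrier[OF i]
      by (simp add: mult_mat_vec[of _ d d] smult_smult_assoc power2_eq_square)
    also have "\<dots> = col (U * D2) i"
      using mult_diag[OF i, of "\<lambda>i. (l i)\<^sup>2"] col_mult2[OF U D2 i] by (simp add: D2_def)
    finally show "col ((A * A) * U) i = col (U * D2) i" .
  qed (use A U D2 in auto)
  hence "U * D2 * transpose_mat U = (A * A) * (U * transpose_mat U)"
    using assoc_mult_mat[OF mult_carrier_mat[OF A A] U UT] by simp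
  hence "A * A = U * D2 * transpose_mat U" using UU' A by simp
  hence "similar_mat_wit (A * A) D2 U (transpose_mat U)"
    using A U D2 UT UU UU' by (intro similar_mat_witI[of _ _ d]) auto
  hence "char_poly (transpose_mat A * A) = char_poly D2"
    unfolding sym by (intro char_poly_similar) (auto simp: similar_mat_def)
  also have "\<dots> = (\<Prod>a\<leftarrow>diag_mat D2. [:- a, 1:])"
    by (rule char_poly_upper_triangular[OF D2]) (auto simp: D2_def)
  also have "diag_mat D2 = map (\<lambda>i. (l i)\<^sup>2) [0..<d]"
    by (auto simp: diag_mat_def D2_def)
  finally have cp: "char_poly (transpose_mat A * A) = (\<Prod>a\<leftarrow>map (\<lambda>i. (l i)\<^sup>2) [0..<d]. [:- a, 1:])" .
  have proots_list: "proots (\<Prod>a\<leftarrow>xs. [:- a, 1:]) = mset xs" for xs :: "real list"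
  proof (induction xs)
    case (Cons x xs)
    have "(\<Prod>a\<leftarrow>xs. [:- a, 1:]) \<noteq> 0" by (auto simp: prod_list_zero_iff)
    hence "proots ([:- x, 1:] * (\<Prod>a\<leftarrow>xs. [:- a, 1:]))
        = proots [:- x, 1:] + proots (\<Prod>a\<leftarrow>xs. [:- a, 1:])"
      by (intro proots_mult) auto
    thus ?case using Cons by (simp only: list.map prod_list.Cons proots_linear_factor) simp
  qed simp
  have "proots (char_poly (transpose_mat A * A)) = image_mset (\<lambda>i. (l i)\<^sup>2) (mset_set {..<d})"
    unfolding cp proots_list by (simp add: lessThan_atLeast0)
  thus ?thesis unfolding singular_values_def by (simp add: image_mset.compositionality o_def)
qed

lemma schatten_norm_infinity:
  assumes "d > 0"
  shows "schatten_norm \<infinity> A = Max ((\<lambda>i. \<bar>l i\<bar>) ` {..<d})"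
  unfolding schatten_norm_def lp_norm_def singular_values_eq by (simp add: image_image)

lemma schatten_norm_finite:
  assumes "p \<noteq> \<infinity>"
  shows "schatten_norm p A
    = (\<Sum>i<d. \<bar>l i\<bar> powr real_of_ereal p) powr (1 / real_of_ereal p)"
  using assms unfolding schatten_norm_def lp_norm_def singular_values_eq
  by (simp add: image_mset.compositionality o_def sum_unfold_sum_mset)

text \<open>These are the only properties of the norm that the filter needs. For finite
  \<open>p\<close> the second one holds since one summand is at most the whole sum; the first one
  follows from it and a nonzero eigenvalue.\<close>

lemma schatten_norm_bounds:
  assumes d: "d > 0" and p: "1 \<le> p" and nz: "A \<noteq> 0\<^sub>m d d"
  shows "schatten_norm p A > 0"
    and "i < d \<Longrightarrow> \<bar>l i\<bar> \<le> schatten_norm p A"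
    and "p \<noteq> \<infinity> \<Longrightarrow> (\<Sum>i<d. \<bar>l i\<bar> powr real_of_ereal p) = schatten_norm p A powr real_of_ereal p"
proof -
  let ?r = "real_of_ereal p" and ?N = "schatten_norm p A"
  have r: "?r \<ge> 1" if "p \<noteq> \<infinity>" using p that by (cases p) auto
  show pow: "(\<Sum>i<d. \<bar>l i\<bar> powr ?r) = ?N powr ?r" if "p \<noteq> \<infinity>"
    using r[OF that] by (simp add: schatten_norm_finite[OF that] powr_powr sum_nonneg)
  have N0: "?N \<ge> 0" if "p \<noteq> \<infinity>" by (simp add: schatten_norm_finite[OF that])
  show bound: "\<bar>l i\<bar> \<le> ?N" if i: "i < d" for i
  proof (cases "p = \<infinity>")
    case True
    thus ?thesis using i d by (auto simp: schatten_norm_infinity intro!: Max_ge)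
  next
    case False
    have "\<bar>l i\<bar> powr ?r \<le> ?N powr ?r"
      unfolding pow[OF False, symmetric] using i by (intro member_le_sum) auto
    thus ?thesis using r[OF False] N0[OF False] by (smt (verit) powr_less_mono2)
  qed
  obtain i where "i < d" "l i \<noteq> 0" using eigenvalues_nonzero[OF nz] by blast
  thus "?N > 0" using bound[of i] by linarith
qed

text \<open>For \<open>v = q(A) g\<close> the coordinate along \<open>col U i\<close> is
  \<open>q (l i)\<close> times that of \<open>g\<close>, and the quadratic form is diagonal in these
  coordinates. The equivalence serves both to exhibit a good \<open>v\<close> and to show that the
  event is measurable.\<close>

lemma krylov_negative_iff:
  assumes g: "g \<in> carrier_vec d"
  shows "(\<exists>v\<in>krylov A g k. v \<bullet> (A *\<^sub>v v) < 0) \<longleftrightarrow>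
    (\<exists>a. (\<Sum>i<d. l i * (\<Sum>m\<le>k. a m * l i ^ m)\<^sup>2 * (col U i \<bullet> g)\<^sup>2) < 0)"
proof -
  define M where "M = mat_of_cols d (map (\<lambda>i. (A ^\<^sub>m i) *\<^sub>v g) [0..<Suc k])"
  have M: "M \<in> carrier_mat d (Suc k)"
    using mat_of_cols_carrier(1)[of d "map (\<lambda>i. (A ^\<^sub>m i) *\<^sub>v g) [0..<Suc k]"] by (simp add: M_def)
  have colM: "col M m = (A ^\<^sub>m m) *\<^sub>v g" if "m < Suc k" for m
    unfolding M_def using that mult_mat_vec_carrier[OF pow_carrier_mat[OF A] g]
    by (subst col_mat_of_cols) (auto simp del: upt_Suc)
  have "(M *\<^sub>v vec (Suc k) a) \<bullet> (A *\<^sub>v (M *\<^sub>v vec (Suc k) a))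
      = (\<Sum>i<d. l i * (\<Sum>m\<le>k. a m * l i ^ m)\<^sup>2 * (col U i \<bullet> g)\<^sup>2)" (is "?L a = ?R a") for a
  proof -
    have "col U i \<bullet> (M *\<^sub>v vec (Suc k) a) = (\<Sum>m\<le>k. a m * l i ^ m) * (col U i \<bullet> g)"
      if i: "i < d" for i
    proof -
      have "col U i \<bullet> (M *\<^sub>v vec (Suc k) a) = (transpose_mat M *\<^sub>v col U i) \<bullet> vec (Suc k) a"
        using transpose_vec_mult_scalar[OF M _ col_carrier[OF i], of "vec (Suc k) a"] by simp
      also have "\<dots> = (\<Sum>m<Suc k. (col M m \<bullet> col U i) * a m)"
        using M by (simp add: scalar_prod_def[of _ "vec (Suc k) a"] lessThan_atLeast0)
      also have "\<dots> = (\<Sum>m<Suc k. (l i ^ m * (col U i \<bullet> g)) * a m)"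
      proof (intro sum.cong refl)
        fix m assume m: "m \<in> {..<Suc k}"
        have "col M m \<bullet> col U i = col U i \<bullet> col M m"
          by (rule comm_scalar_prod[of _ d]) (use M col_carrier[OF i] m in auto)
        also have "\<dots> = l i ^ m * (col U i \<bullet> g)"
          using colM m eigenvector_scalar_prod_pow[OF A sym col_carrier[OF i] eigen[OF i] g] by simp
        finally show "(col M m \<bullet> col U i) * a m = (l i ^ m * (col U i \<bullet> g)) * a m" by simp
      qed
      finally show ?thesis by (simp add: sum_distrib_left sum_distrib_right lessThan_Suc_atMost mult_ac)
    qed
    thus ?thesis using M by (subst quadratic_form) (auto simp: power_mult_distrib mult.assoc)
  qed
  thus ?thesis unfolding Bex_def mem_krylov_iff[OF A g] M_def[symmetric] by auto
qed

end

lemma orthogonal_diagonalization_exists: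
  fixes A :: "real mat"
  assumes A: "A \<in> carrier_mat d d" "transpose_mat A = A"
  shows "\<exists>U l. orthogonal_diagonalization A U l d"
proof -
  obtain U D where UD: "U \<in> carrier_mat d d" "D \<in> carrier_mat d d" "diagonal_mat D"
    "transpose_mat U * U = 1\<^sub>m d" "A * U = U * D"
    using real_symmetric_diagonalization[OF A] by blast
  have D: "mat d d (\<lambda>(i,j). if i = j then D $$ (i,i) else 0) = D"
    using UD(2,3) by (intro eq_matI) (auto simp: diagonal_mat_def)
  have "orthogonal_diagonalization A U (\<lambda>i. D $$ (i,i)) d"
    using A UD(1,4,5) by unfold_locales (simp_all only: D)
  thus ?thesis by blast
qed

subsection \<open>Filter polynomials\<close>

text \<open>The Chebyshev polynomials of the first kind, given by their three-term
  recurrence.\<close>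

fun cheb_poly :: "nat \<Rightarrow> real poly" where
  "cheb_poly 0 = 1"
| "cheb_poly (Suc 0) = [:0, 1:]"
| "cheb_poly (Suc (Suc n)) = [:0, 2:] * cheb_poly (Suc n) - cheb_poly n"

lemma degree_cheb_poly: "degree (cheb_poly n) \<le> n"
proof (induction n rule: cheb_poly.induct)
  case (3 n)
  have "degree ([:0, 2:] * cheb_poly (Suc n)) \<le> Suc (Suc n)"
    using 3(1) by (intro order.trans[OF degree_mult_le]) simp
  thus ?case using 3(2) by (simp add: degree_diff_le del: mult_pCons_left)
qed simp_all

lemma poly_cheb_poly_cos: "poly (cheb_poly n) (cos \<theta>) = cos (real n * \<theta>)"
proof (induction n rule: cheb_poly.induct)
  case (3 n)
  have "cos (real (Suc (Suc n)) * \<theta>) = 2 * cos \<theta> * cos (real (Suc n) * \<theta>) - cos (real n * \<theta>)"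
    using cos_add[of "real (Suc n) * \<theta>" \<theta>] cos_diff[of "real (Suc n) * \<theta>" \<theta>]
    by (simp add: algebra_simps)
  thus ?case using 3 by simp
qed simp_all

lemma abs_poly_cheb_poly_le_1:
  assumes "\<bar>x\<bar> \<le> 1"
  shows "\<bar>poly (cheb_poly n) x\<bar> \<le> 1"
  using poly_cheb_poly_cos[of n "arccos x"] cos_arccos_abs[OF assms] by simp

text \<open>The right-hand side satisfies the recurrence of \<open>cheb_poly\<close>. It replaces
  the cosine formula at arguments of absolute value at least 1, which have the form
  \<open>(z + 1 / z) / 2\<close> with real \<open>z\<close>.\<close>

lemma poly_cheb_poly_Joukowski:
  assumes zw: "z * w = 1"
  shows "poly (cheb_poly n) ((z + w) / 2) = (z ^ n + w ^ n) / 2"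
proof (induction n rule: cheb_poly.induct)
  case (3 n)
  have "(z + w) * (z ^ Suc n + w ^ Suc n)
      = z ^ Suc (Suc n) + w ^ Suc (Suc n) + (z * w) * (z ^ n + w ^ n)"
    by (simp add: algebra_simps)
  hence rec: "((z + w) * (z ^ Suc n + w ^ Suc n) - (z ^ n + w ^ n)) / 2
      = (z ^ Suc (Suc n) + w ^ Suc (Suc n)) / 2"
    using zw by simp
  have "poly (cheb_poly (Suc (Suc n))) ((z + w) / 2)
      = (z + w) * poly (cheb_poly (Suc n)) ((z + w) / 2) - poly (cheb_poly n) ((z + w) / 2)"
    by simp
  also have "\<dots> = ((z + w) * (z ^ Suc n + w ^ Suc n) - (z ^ n + w ^ n)) / 2"
    unfolding 3 by (simp add: diff_divide_distrib)
  finally show ?case using rec by (simp only:)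
qed simp_all

lemma one_plus_twice_ge_exp:
  fixes s :: real
  assumes "0 \<le> s" "s \<le> 1"
  shows "exp s \<le> 1 + 2 * s"
proof -
  have "exp s \<le> 1 + s + s\<^sup>2" using exp_bound[of s] assms by simp
  moreover have "s\<^sup>2 \<le> s" using assms by (simp add: power2_eq_square mult_left_le)
  ultimately show ?thesis by simp
qed

text \<open>Write \<open>x = (z + 1 / z) / 2\<close> with
  \<open>z = x + sqrt (x\<^sup>2 - 1)\<close>. Since
  \<open>x\<^sup>2 - 1 = (x - 1) * (x + 1) \<ge> 4 * s\<^sup>2\<close>, this \<open>z\<close> is at
  least \<open>1 + 2 * s \<ge> exp s\<close>. A distance of order \<open>s\<^sup>2\<close> beyond 1
  thus already gives growth at rate \<open>s\<close>; this is the source of the square root in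
  \<open>E\<close> below.\<close>

lemma poly_cheb_poly_growth:
  assumes s: "0 \<le> s" "s \<le> 1" and x: "x \<ge> 1 + 2 * s\<^sup>2"
  shows "poly (cheb_poly n) x \<ge> exp (real n * s) / 2"
proof -
  define r where "r = sqrt (x\<^sup>2 - 1)"
  define z where "z = x + r"
  have x1: "x \<ge> 1" using x by (smt (verit) zero_le_power2)
  have "x\<^sup>2 \<ge> 1" using x1 by simp
  hence r2: "r\<^sup>2 = x\<^sup>2 - 1" by (simp add: r_def)
  have "(2 * s)\<^sup>2 \<le> (x - 1) * (x + 1)"
    using mult_mono[of "2 * s\<^sup>2" "x - 1" 2 "x + 1"] x x1 by (simp add: power2_eq_square)
  also have "\<dots> = r\<^sup>2" unfolding r2 by (simp add: algebra_simps power2_eq_square)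
  finally have rs: "r \<ge> 2 * s" by (rule power2_le_imp_le) (use x1 in \<open>simp add: r_def\<close>)
  have z: "z \<ge> 1 + 2 * s" using rs x1 by (simp add: z_def)
  have z0: "z > 0" using z s by linarith
  have zw: "z * (x - r) = 1"
  proof -
    have "z * (x - r) = x\<^sup>2 - r\<^sup>2" by (simp add: z_def algebra_simps power2_eq_square)
    thus ?thesis using r2 by simp
  qed
  hence w0: "x - r > 0" using z0 zero_less_mult_pos[of z "x - r"] by simp
  have "poly (cheb_poly n) x = (z ^ n + (x - r) ^ n) / 2"
    using poly_cheb_poly_Joukowski[OF zw, of n] by (simp add: z_def)
  hence "poly (cheb_poly n) x \<ge> z ^ n / 2" using w0 by simp
  moreover have "z ^ n \<ge> exp s ^ n"
    using one_plus_twice_ge_exp[OF s] z by (intro power_mono) auto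
  ultimately show ?thesis by (simp add: exp_of_nat_mult)
qed

text \<open>The witness is \<open>Q * T\<close>: \<open>Q\<close> vanishes at the eigenvalues above
  \<open>t\<close>, and \<open>T\<close> is a Chebyshev polynomial moved to \<open>[0, t]\<close>.
  Both are bounded by 1 at the eigenvalues in \<open>(0, t]\<close>, while at \<open>\<mu> j\<close>
  the first is at least 1 and the second at least \<open>exp m / 2\<close>. Of the degree,
  \<open>E\<close> pays for the roots and \<open>m * E\<close> for the growth.\<close>

lemma deflated_chebyshev_poly_exists:
  fixes \<mu> :: "nat \<Rightarrow> real" and \<epsilon> t S :: real
  assumes \<epsilon>: "0 < \<epsilon>" "\<epsilon> \<le> t"
    and large: "real (card {i. i < d \<and> t < \<mu> i}) \<le> E"
    and small: "(\<Sum>i | i < d \<and> 0 < \<mu> i \<and> \<mu> i \<le> t. \<mu> i) \<le> S"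
    and j: "\<mu> j \<le> - \<epsilon>"
    and E: "E = sqrt (t / \<epsilon>)" "real k \<ge> E + m * E" "m > 0"
    and S: "1000 * S / \<epsilon> < exp (2 * m)" 
  shows "\<exists>q. degree q \<le> k \<and>
    250 * (\<Sum>i | i < d \<and> 0 < \<mu> i. \<mu> i * (poly q (\<mu> i))\<^sup>2) < - \<mu> j * (poly q (\<mu> j))\<^sup>2"
proof -
  define B where "B = {i. i < d \<and> t < \<mu> i}"
  define G where "G = {i. i < d \<and> 0 < \<mu> i \<and> \<mu> i \<le> t}"
  \<comment> \<open>The degree that remains for \<open>T\<close>; the subtraction does not truncate,
    by \<open>Bk\<close> below.\<close>
  define n where "n = k - card B"
  \<comment> \<open>The affine map sends \<open>[0, t]\<close> onto \<open>[-1, 1]\<close> and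
    \<open>-\<epsilon>\<close> to \<open>1 + 2 * \<epsilon> / t = 1 + 2 * s\<^sup>2\<close>.\<close>
  define T where "T = pcompose (cheb_poly n) [:1, -2 / t:]"
  \<comment> \<open>With value 1 at 0, each factor lies in \<open>[0, 1]\<close> on
    \<open>[0, t]\<close> and is at least 1 on the negative axis.\<close>
  define Q where "Q = (\<Prod>i\<in>B. [:1, -1 / \<mu> i:])"
  define s where "s = sqrt (\<epsilon> / t)"
  have t: "t > 0" using \<epsilon> by linarith
  have finB: "finite B" "finite G" by (auto simp: B_def G_def)
  have s: "0 < s" "s \<le> 1" "s\<^sup>2 = \<epsilon> / t" using \<epsilon> t by (auto simp: s_def)
  have E0: "E > 0" unfolding E using \<epsilon> t by simp
  have Es: "E * s = 1" using \<epsilon> t unfolding E s_def by (simp flip: real_sqrt_mult)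
  have cardB: "real (card B) \<le> E" using large by (simp add: B_def)
  have "real (card B) \<le> real k" using cardB E E0 by (smt (verit) mult_pos_pos)
  hence Bk: "card B \<le> k" by simp
  have n: "real n \<ge> m * E" using Bk cardB E(2) by (simp add: n_def of_nat_diff)
  have ns: "real n * s \<ge> m"
    using mult_right_mono[OF n, of s] s Es by (simp add: mult.assoc)
  have degT: "degree T \<le> n"
  proof -
    have "degree T \<le> degree (cheb_poly n) * degree [:1, -2 / t:]"
      unfolding T_def by (rule degree_pcompose_le)
    also have "\<dots> \<le> n * 1" by (intro mult_mono degree_cheb_poly) auto
    finally show ?thesis by simp
  qed
  have degQ: "degree Q \<le> card B"
  proof -
    have "degree Q \<le> sum (degree \<circ> (\<lambda>i. [:1, -1 / \<mu> i:])) B"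
      unfolding Q_def by (rule degree_prod_sum_le[OF finB(1)])
    also have "\<dots> \<le> of_nat (card B) * 1" by (rule sum_bounded_above) simp
    finally show ?thesis by simp
  qed
  have deg: "degree (Q * T) \<le> k"
    using degree_mult_le[of Q T] degT degQ Bk by (simp add: n_def)
  have polyQ: "poly Q x = (\<Prod>i\<in>B. 1 - x / \<mu> i)" for x
    by (simp add: Q_def poly_prod field_simps)
  have polyT: "poly T x = poly (cheb_poly n) (1 - 2 * x / t)" for x
    by (simp add: T_def poly_pcompose mult.commute)
  have zero: "poly (Q * T) (\<mu> i) = 0" if "i \<in> B" for i
    using that finB t by (auto simp: polyQ B_def intro!: bexI[of _ i])
  have le1: "(poly (Q * T) (\<mu> i))\<^sup>2 \<le> 1" if "i \<in> G" for i
  proof -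
    have mi: "0 < \<mu> i" "\<mu> i \<le> t" using that by (auto simp: G_def)
    have "\<bar>poly Q (\<mu> i)\<bar> \<le> 1"
      unfolding polyQ abs_prod using mi by (intro prod_le_1) (auto simp: B_def field_simps)
    moreover have "\<bar>poly T (\<mu> i)\<bar> \<le> 1"
      unfolding polyT using mi t by (intro abs_poly_cheb_poly_le_1) (auto simp: abs_le_iff field_simps)
    ultimately have "\<bar>poly (Q * T) (\<mu> i)\<bar> \<le> 1" by (simp add: abs_mult mult_le_one)
    thus ?thesis by (simp add: abs_square_le_1)
  qed
  have big: "poly (Q * T) (\<mu> j) \<ge> exp m / 2"
  proof -
    have "poly Q (\<mu> j) \<ge> 1"
      unfolding polyQ using j \<epsilon> t by (intro prod_ge_1) (auto simp: B_def field_simps)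
    moreover have "poly T (\<mu> j) \<ge> exp (real n * s) / 2"
      unfolding polyT using s j t by (intro poly_cheb_poly_growth) (auto simp: field_simps)
    hence "exp m / 2 \<le> poly T (\<mu> j)"
      using ns by (smt (verit) exp_le_cancel_iff divide_right_mono)
    ultimately have "1 * (exp m / 2) \<le> poly Q (\<mu> j) * poly T (\<mu> j)"
      by (intro mult_mono) auto
    thus ?thesis by simp
  qed
  have "(\<Sum>i | i < d \<and> 0 < \<mu> i. \<mu> i * (poly (Q * T) (\<mu> i))\<^sup>2)
      = (\<Sum>i\<in>G. \<mu> i * (poly (Q * T) (\<mu> i))\<^sup>2)"
  proof (rule sum.mono_neutral_right)
    show "\<forall>i\<in>{i. i < d \<and> 0 < \<mu> i} - G. \<mu> i * (poly (Q * T) (\<mu> i))\<^sup>2 = 0"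
    proof
      fix i assume "i \<in> {i. i < d \<and> 0 < \<mu> i} - G"
      hence "i \<in> B" by (auto simp: B_def G_def)
      thus "\<mu> i * (poly (Q * T) (\<mu> i))\<^sup>2 = 0" using zero by simp
    qed
  qed (auto simp: G_def)
  also have "\<dots> \<le> (\<Sum>i\<in>G. \<mu> i)"
    using le1 by (intro sum_mono mult_left_le) (auto simp: G_def simp del: poly_mult)
  also have "\<dots> \<le> S" using small by (simp add: G_def)
  finally have "250 * (\<Sum>i | i < d \<and> 0 < \<mu> i. \<mu> i * (poly (Q * T) (\<mu> i))\<^sup>2) \<le> 250 * S" by simp
  \<comment> \<open>The square of \<open>exp m / 2\<close> loses a factor 4, whence
    \<open>1000 = 4 * 250\<close> in the hypothesis on \<open>S\<close>.\<close>
  also have "\<dots> < \<epsilon> * (exp m / 2)\<^sup>2"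
    using S \<epsilon> by (simp add: field_simps power2_eq_square flip: exp_add)
  also have "\<dots> \<le> - \<mu> j * (poly (Q * T) (\<mu> j))\<^sup>2"
    using j \<epsilon> big by (intro mult_mono power_mono) auto
  finally show ?thesis using deg by blast
qed

text \<open>Ten copies of \<open>a\<close> absorb \<open>1000 < 2 ^ 10\<close>, since
  \<open>a \<ge> ln 2\<close>, and the eleventh is the factor
  \<open>1 / \<epsilon> = exp a\<close>.\<close>

lemma exp_ge_1000_mult:
  fixes a L S m \<epsilon> :: real
  assumes "a \<ge> ln 2" "2 * m \<ge> 11 * a + ln S" "S > 0" "a = ln (1 / \<epsilon>)" "\<epsilon> > 0"
  shows "1000 * S / \<epsilon> < exp (2 * m)"
proof -
  have "(1000 :: real) < exp (10 * ln 2)" by (simp add: exp_of_nat_mult[of 10 "ln 2 :: real", simplified])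
  also have "\<dots> \<le> exp (10 * a)" using assms by simp
  finally have "1000 * (S * exp a) < exp (10 * a) * (S * exp a)" using assms(3) by simp
  also have "\<dots> = exp (11 * a + ln S)" using assms(3) by (simp add: exp_add[symmetric] exp_add)
  also have "\<dots> \<le> exp (2 * m)" using assms by simp
  finally show ?thesis using assms by simp
qed

text \<open>This fixes the parameters of the deflated Chebyshev polynomial for eigenvalues
  normalised to norm at most 1, with \<open>m = 12 * L\<close>.\<close>

lemma krylov_filter_poly_exists:
  fixes \<mu> :: "nat \<Rightarrow> real" and \<epsilon> :: real and p :: ereal
  assumes d: "2 \<le> d" and p: "1 \<le> p" and \<epsilon>: "0 < \<epsilon>" "\<epsilon> \<le> 1 / 2"
    and \<mu>1: "\<And>i. i < d \<Longrightarrow> \<bar>\<mu> i\<bar> \<le> 1"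
    and \<mu>p: "p \<noteq> \<infinity> \<Longrightarrow> (\<Sum>i<d. \<bar>\<mu> i\<bar> powr real_of_ereal p) \<le> 1"
    and j: "\<mu> j \<le> - \<epsilon>"
    and k: "p = 1 \<and> real k \<ge> 16 * (1 / \<epsilon>) powr (1 / 3) * ln (1 / \<epsilon>) \<or>
       p > 1 \<and> real k \<ge> 16 * (1 / \<epsilon>) powr krylov_exponent p * ln (1 / \<epsilon>) * ln (real d)"
  shows "\<exists>q. degree q \<le> k \<and>
    250 * (\<Sum>i | i < d \<and> 0 < \<mu> i. \<mu> i * (poly q (\<mu> i))\<^sup>2) < - \<mu> j * (poly q (\<mu> j))\<^sup>2"
proof -
  define a where "a = ln (1 / \<epsilon>)"
  define b where "b = ln (real d)"
  define E where "E = (1 / \<epsilon>) powr krylov_exponent p"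
  define L where "L = (if p = 1 then a else a * b)"
  \<comment> \<open>For \<open>p = 1\<close> the normalisation bounds the sum of the small positive
    eigenvalues by 1; otherwise each is at most 1 and there are at most \<open>d\<close> of
    them.\<close>
  define S where "S = (if p = 1 then 1 else real d)"
  define r where "r = real_of_ereal p"
  \<comment> \<open>At \<open>p = \<infinity>\<close> the exponent is replaced by its limit 0, so
    \<open>t = 1\<close> and no eigenvalue exceeds \<open>t\<close>.\<close>
  define t where "t = (if p = \<infinity> then 1 else \<epsilon> powr (1 / (2 * r + 1)))"
  have a2: "a \<ge> ln 2" unfolding a_def using \<epsilon> by (simp add: field_simps)
  have "ln 2 \<le> b" unfolding b_def using d by (subst ln_le_cancel_iff) auto
  hence ab: "a \<ge> 1 / 2" "b \<ge> 1 / 2" using a2 ln2_ge_two_thirds by linarith+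
  \<comment> \<open>\<open>krylov_exponent 1\<close> is \<open>1 / 3\<close>, so both alternatives
    in the hypothesis take this common form.\<close>
  have k': "real k \<ge> 16 * E * L"
    using k by (auto simp: E_def L_def krylov_exponent_def a_def b_def mult.assoc)
  have L: "L \<ge> 1 / 4" using ab mult_mono[of "1/2" a "1/2" b] by (auto simp: L_def)
  have r: "r \<ge> 1" if "p \<noteq> \<infinity>" using p that unfolding r_def by (cases p) auto
  have t: "\<epsilon> \<le> t" "t \<le> 1"
  proof -
    have "\<epsilon> powr 1 \<le> \<epsilon> powr (1 / (2 * r + 1))" if "p \<noteq> \<infinity>"
      using r[OF that] \<epsilon> by (intro powr_mono') auto
    thus "\<epsilon> \<le> t" using \<epsilon> by (auto simp: t_def)
    have "\<epsilon> powr (1 / (2 * r + 1)) \<le> 1" if "p \<noteq> \<infinity>"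
      using r[OF that] \<epsilon> by (intro powr_le1) auto
    thus "t \<le> 1" by (auto simp: t_def)
  qed
  have E_t: "E = sqrt (t / \<epsilon>)"
  proof (cases "p = \<infinity>")
    case True
    thus ?thesis using \<epsilon> by (simp add: E_def t_def krylov_exponent_def powr_half_sqrt)
  next
    case False
    have "t / \<epsilon> = \<epsilon> powr (1 / (2 * r + 1) - 1)"
      using False \<epsilon> by (simp add: t_def powr_diff)
    also have "1 / (2 * r + 1) - 1 = - 2 * (r / (2 * r + 1))"
      using r[OF False] by (simp add: field_simps)
    finally have te: "t / \<epsilon> = \<epsilon> powr (- 2 * (r / (2 * r + 1)))" .
    have "sqrt (t / \<epsilon>) = (\<epsilon> powr (- 2 * (r / (2 * r + 1)))) powr (1 / 2)"
      unfolding te by (simp add: powr_half_sqrt)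
    also have "\<dots> = \<epsilon> powr (- 2 * (r / (2 * r + 1)) * (1 / 2))" by (rule powr_powr)
    also have "- 2 * (r / (2 * r + 1)) * (1 / 2) = - (r / (2 * r + 1))"
      using r[OF False] by (simp add: field_simps)
    also have "\<epsilon> powr (- (r / (2 * r + 1))) = E"
      using False \<epsilon> by (simp add: E_def krylov_exponent_def r_def powr_minus_divide powr_divide)
    finally show ?thesis by simp
  qed
  have E0: "E > 0" using \<epsilon> by (simp add: E_def)
  \<comment> \<open>Each counted eigenvalue contributes at least \<open>t powr r = 1 / E\<close> to
    a sum that is at most 1.\<close>
  have large: "real (card {i. i < d \<and> t < \<mu> i}) \<le> E"
  proof (cases "p = \<infinity>")
    case True
    hence empty: "{i. i < d \<and> t < \<mu> i} = {}" using \<mu>1 by (fastforce simp: t_def)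
    show ?thesis unfolding empty using E0 by simp
  next
    case False
    define B where "B = {i. i < d \<and> t < \<mu> i}"
    have "real (card B) * t powr r = (\<Sum>i\<in>B. t powr r)" by simp
    also have "\<dots> \<le> (\<Sum>i\<in>B. \<bar>\<mu> i\<bar> powr r)"
      using r[OF False] t \<epsilon> by (intro sum_mono powr_mono2) (auto simp: B_def)
    also have "\<dots> \<le> (\<Sum>i<d. \<bar>\<mu> i\<bar> powr r)" by (intro sum_mono2) (auto simp: B_def)
    also have "\<dots> \<le> 1" using \<mu>p[OF False] by (simp add: r_def)
    also have "t powr r = 1 / E"
      using False \<epsilon> by (simp add: t_def E_def krylov_exponent_def r_def powr_powr powr_divide)
    finally show ?thesis using E0 by (simp add: B_def field_simps)
  qed
  have small: "(\<Sum>i | i < d \<and> 0 < \<mu> i \<and> \<mu> i \<le> t. \<mu> i) \<le> S"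
  proof (cases "p = 1")
    case True
    have "(\<Sum>i | i < d \<and> 0 < \<mu> i \<and> \<mu> i \<le> t. \<mu> i) \<le> (\<Sum>i<d. \<bar>\<mu> i\<bar>)"
      by (intro sum_le_included[where i = id]) auto
    thus ?thesis using \<mu>p True by (simp add: S_def)
  next
    case False
    have "(\<Sum>i | i < d \<and> 0 < \<mu> i \<and> \<mu> i \<le> t. \<mu> i) \<le> (\<Sum>i<d. 1)"
      using \<mu>1 by (intro sum_le_included[where i = id]) force+
    thus ?thesis using False by (simp add: S_def)
  qed
  \<comment> \<open>\<open>16 = 12 + 4\<close>: since \<open>L \<ge> 1 / 4\<close>, the part
    \<open>4 * L * E\<close> covers the degree \<open>E\<close> of the roots.\<close>
  have kE: "real k \<ge> E + 12 * L * E"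
  proof -
    have "E * 1 \<le> E * (4 * L)" using L E0 by (intro mult_left_mono) auto
    thus ?thesis using k' by (simp add: algebra_simps)
  qed
  \<comment> \<open>For \<open>p \<noteq> 1\<close> split \<open>24 * a * b\<close> as
    \<open>22 * a * b + 2 * a * b\<close>, which is at least \<open>11 * a + b\<close> because
    \<open>a\<close> and \<open>b\<close> are at least \<open>1 / 2\<close>.\<close>
  have "2 * (12 * L) \<ge> 11 * a + ln S"
  proof (cases "p = 1")
    case True thus ?thesis using ab by (simp add: L_def S_def)
  next
    case False
    have "a * (1 / 2) \<le> a * b" "1 / 2 * b \<le> a * b"
      using ab by (auto intro!: mult_mono)
    thus ?thesis using False by (simp add: L_def S_def b_def)
  qed
  moreover have "S > 0" using d by (simp add: S_def)
  ultimately have "1000 * S / \<epsilon> < exp (2 * (12 * L))"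
    using \<epsilon>(1) by (rule exp_ge_1000_mult[OF a2 _ _ a_def])
  thus ?thesis
    using deflated_chebyshev_poly_exists[OF \<epsilon>(1) t(1) large small j E_t kE] L by simp
qed

text \<open>Dividing the eigenvalues by \<open>N\<close> and composing \<open>q\<close> with
  \<open>x / N\<close> keeps the degree bound and scales both sides of the inequality by the same
  factor.\<close>

lemma krylov_filter_poly_exists_scaled:
  fixes l :: "nat \<Rightarrow> real" and \<epsilon> :: real and p :: ereal
  assumes d: "2 \<le> d" and p: "1 \<le> p" and \<epsilon>: "0 < \<epsilon>" "\<epsilon> \<le> 1 / 2" and N: "N > 0"
    and l1: "\<And>i. i < d \<Longrightarrow> \<bar>l i\<bar> \<le> N"
    and lp: "p \<noteq> \<infinity> \<Longrightarrow> (\<Sum>i<d. \<bar>l i\<bar> powr real_of_ereal p) \<le> N powr real_of_ereal p"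
    and j: "l j \<le> - \<epsilon> * N"
    and k: "p = 1 \<and> real k \<ge> 16 * (1 / \<epsilon>) powr (1 / 3) * ln (1 / \<epsilon>) \<or>
       p > 1 \<and> real k \<ge> 16 * (1 / \<epsilon>) powr krylov_exponent p * ln (1 / \<epsilon>) * ln (real d)"
  shows "\<exists>q. degree q \<le> k \<and>
    250 * (\<Sum>i | i < d \<and> 0 < l i. l i * (poly q (l i))\<^sup>2) < - l j * (poly q (l j))\<^sup>2"
proof -
  define \<mu> where "\<mu> = (\<lambda>i. l i / N)"
  have l\<mu>: "l i = N * \<mu> i" for i using N by (simp add: \<mu>_def)
  have "\<bar>\<mu> i\<bar> \<le> 1" if "i < d" for i using l1[OF that] N by (simp add: \<mu>_def field_simps)
  moreover have "(\<Sum>i<d. \<bar>\<mu> i\<bar> powr real_of_ereal p) \<le> 1" if "p \<noteq> \<infinity>"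
    using lp[OF that] N by (simp add: \<mu>_def powr_divide flip: sum_divide_distrib)
  moreover have "\<mu> j \<le> - \<epsilon>" using j N by (simp add: \<mu>_def field_simps)
  ultimately obtain q where q: "degree q \<le> k"
    "250 * (\<Sum>i | i < d \<and> 0 < \<mu> i. \<mu> i * (poly q (\<mu> i))\<^sup>2) < - \<mu> j * (poly q (\<mu> j))\<^sup>2"
    using krylov_filter_poly_exists[OF d p \<epsilon> _ _ _ k, of \<mu> j] by blast
  define q' where "q' = pcompose q [:0, 1 / N:]"
  have q': "poly q' (l i) = poly q (\<mu> i)" for i
    by (simp add: q'_def poly_pcompose \<mu>_def)
  have "degree q' \<le> degree q * degree [:0, 1 / N:]"
    unfolding q'_def by (rule degree_pcompose_le)
  also have "\<dots> \<le> degree q" by simp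
  finally have "degree q' \<le> k" using q(1) by simp
  moreover have "250 * (\<Sum>i | i < d \<and> 0 < l i. l i * (poly q' (l i))\<^sup>2) < - l j * (poly q' (l j))\<^sup>2"
    unfolding q' using mult_strict_left_mono[OF q(2) N] N
    by (simp add: l\<mu> sum_distrib_left zero_less_mult_iff mult.assoc mult.left_commute)
  ultimately show ?thesis by blast
qed

subsection \<open>Gaussian quadratic forms\<close>

lemma prob_space_std_gaussian: "prob_space (std_gaussian d)"
  unfolding std_gaussian_def by (intro prob_space_PiM prob_space_normal_density) simp

lemma sets_std_gaussian [measurable_cong]:
  "sets (std_gaussian d) = sets (Pi\<^sub>M {..<d} (\<lambda>_. borel :: real measure))"
  unfolding std_gaussian_def by (intro sets_PiM_cong) auto

lemma space_std_gaussian: "space (std_gaussian d) = {..<d} \<rightarrow>\<^sub>E (UNIV :: real set)"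
  by (simp add: std_gaussian_def space_PiM)

lemma measurable_std_gaussian_component [measurable]:
  "i < d \<Longrightarrow> (\<lambda>g. g i) \<in> borel_measurable (std_gaussian d)"
  by measurable

lemma std_gaussian_component:
  assumes "i < d"
  shows "distributed (std_gaussian d) lborel (\<lambda>g. g i) std_normal_density"
proof -
  have "distr (std_gaussian d) (density lborel std_normal_density) (\<lambda>g. g i)
      = density lborel std_normal_density"
    unfolding std_gaussian_def using assms
    by (intro distr_PiM_component) (auto intro: prob_space_normal_density)
  moreover have "distr (std_gaussian d) (density lborel std_normal_density) (\<lambda>g. g i)
      = distr (std_gaussian d) lborel (\<lambda>g. g i)"
    by (intro distr_cong) auto
  ultimately show ?thesis using assms unfolding distributed_def by auto
qed

text \<open>The joint law of the coordinates is the product measure itself, which is the product of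
  their laws. The criterion used concerns nonempty index sets, whence \<open>d > 0\<close>.\<close>

lemma indep_vars_std_gaussian:
  assumes "d > 0"
  shows "prob_space.indep_vars (std_gaussian d) (\<lambda>_. borel) (\<lambda>i g. g i) {..<d}"
proof -
  interpret prob_space "std_gaussian d" by (rule prob_space_std_gaussian)
  have "distr (std_gaussian d) (Pi\<^sub>M {..<d} (\<lambda>_. borel)) (\<lambda>g. restrict g {..<d})
      = distr (std_gaussian d) (std_gaussian d) (\<lambda>g. g)"
    by (intro distr_cong) (auto simp: sets_std_gaussian space_std_gaussian PiE_restrict)
  also have "\<dots> = std_gaussian d" by simp
  also have "\<dots> = Pi\<^sub>M {..<d} (\<lambda>i. distr (std_gaussian d) borel (\<lambda>g. g i))"
    unfolding std_gaussian_def
  proof (intro PiM_cong refl)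
    fix i assume i: "i \<in> {..<d}"
    have "distr (std_gaussian d) borel (\<lambda>g. g i) = distr (std_gaussian d) lborel (\<lambda>g. g i)"
      by (intro distr_cong) auto
    also have "\<dots> = density lborel std_normal_density"
      using std_gaussian_component[of i d] i by (auto simp: distributed_def)
    finally show "density lborel std_normal_density
        = distr (Pi\<^sub>M {..<d} (\<lambda>_. density lborel std_normal_density)) borel (\<lambda>g. g i)"
      by (simp add: std_gaussian_def)
  qed
  finally show ?thesis
    using assms by (subst indep_vars_iff_distr_eq_PiM') auto
qed

text \<open>A sum of independent centred normal variables is normal, and its variance is here the
  squared length of \<open>u\<close>.\<close>

lemma std_gaussian_linear_form:
  assumes u: "(\<Sum>j<d. (u j)\<^sup>2) = 1"
  shows "distributed (std_gaussian d) lborel (\<lambda>g. \<Sum>j<d. u j * g j) std_normal_density"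
proof -
  interpret prob_space "std_gaussian d" by (rule prob_space_std_gaussian)
  \<comment> \<open>Zero coefficients are dropped because a normal density needs a positive standard
    deviation.\<close>
  define J where "J = {j. j < d \<and> u j \<noteq> 0}"
  have sum_J: "(\<Sum>j\<in>J. (u j)\<^sup>2) = 1"
    unfolding u[symmetric] by (intro sum.mono_neutral_left) (auto simp: J_def)
  hence J: "J \<noteq> {}" by auto
  hence d: "d > 0" by (auto simp: J_def)
  have "indep_vars (\<lambda>_. borel) (\<lambda>i g. g i) J"
    by (rule indep_vars_subset[OF indep_vars_std_gaussian[OF d]]) (auto simp: J_def)
  hence "indep_vars (\<lambda>_. borel) (\<lambda>j g. u j * g j) J"
    by (rule indep_vars_compose2) auto
  moreover have "distributed (std_gaussian d) lborel (\<lambda>g. u j * g j) (normal_density 0 \<bar>u j\<bar>)"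
    if "j \<in> J" for j
    using normal_density_affine[OF std_gaussian_component[of j d], of "u j" 0] that
    by (simp add: J_def)
  ultimately have "distributed (std_gaussian d) lborel (\<lambda>g. \<Sum>j\<in>J. u j * g j)
      (normal_density (\<Sum>j\<in>J. 0) (sqrt (\<Sum>j\<in>J. \<bar>u j\<bar>\<^sup>2)))"
    by (intro sum_indep_normal) (use J in \<open>auto simp: J_def\<close>)
  moreover have "(\<Sum>j\<in>J. u j * g j) = (\<Sum>j<d. u j * g j)" for g
    by (intro sum.mono_neutral_left) (auto simp: J_def)
  ultimately show ?thesis using sum_J by simp
qed

lemma (in prob_space) standard_normal_second_moment:
  assumes X: "distributed M lborel X std_normal_density"
  shows "integrable M (\<lambda>x. (X x)\<^sup>2)" "expectation (\<lambda>x. (X x)\<^sup>2) = 1"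
proof -
  show "integrable M (\<lambda>x. (X x)\<^sup>2)"
    using distributed_integrable[OF X, of "\<lambda>x. x\<^sup>2"] integrable_std_normal_moment[of 2] by simp
  show "expectation (\<lambda>x. (X x)\<^sup>2) = 1"
    using standard_normal_distributed_variance[OF X] standard_normal_distributed_expectation[OF X]
    by simp
qed

text \<open>The density is at most \<open>1 / 2\<close>, as \<open>sqrt (2 * pi) \<ge> 2\<close>,
  and the interval has length \<open>2 * s\<close>.\<close>

lemma (in prob_space) standard_normal_anticoncentration:
  assumes X: "distributed M lborel X std_normal_density" and s: "0 \<le> s"
  shows "prob {x \<in> space M. \<bar>X x\<bar> < s} \<le> s"
proof -
  have meas: "X \<in> borel_measurable M" using X by (auto simp: distributed_def)
  have eq: "{x \<in> space M. \<bar>X x\<bar> < s} = X -` {-s<..<s} \<inter> space M" by auto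
  have dens: "std_normal_density x \<le> 1 / 2" for x
  proof -
    have "2 \<le> sqrt (2 * pi)" using pi_ge_two by (intro real_le_rsqrt) simp
    hence "1 / sqrt (2 * pi) \<le> 1 / 2" by (simp add: field_simps)
    moreover have "exp (- x\<^sup>2 / 2) \<le> 1" by simp
    ultimately have "1 / sqrt (2 * pi) * exp (- x\<^sup>2 / 2) \<le> 1 / 2 * 1"
      by (intro mult_mono) auto
    thus ?thesis by (simp add: std_normal_density_def)
  qed
  have "emeasure M (X -` {-s<..<s} \<inter> space M)
      = (\<integral>\<^sup>+x. ennreal (std_normal_density x) * indicator {-s<..<s} x \<partial>lborel)"
    using distributed_emeasure[OF X, of "{-s<..<s}"] by simp
  also have "\<dots> \<le> (\<integral>\<^sup>+x. ennreal (1 / 2) * indicator {-s<..<s} x \<partial>lborel)"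
    using dens by (intro nn_integral_mono mult_right_mono ennreal_leI) auto
  also have "\<dots> = ennreal (1 / 2) * emeasure lborel {-s<..<s}"
    by (rule nn_integral_cmult_indicator) simp
  also have "emeasure lborel {-s<..<s} = ennreal (2 * s)" using s by simp
  also have "ennreal (1 / 2) * ennreal (2 * s) = ennreal (1 / 2 * (2 * s))"
    using s by (intro ennreal_mult[symmetric]) auto
  also have "\<dots> = ennreal s" by simp
  finally show ?thesis using s unfolding eq emeasure_eq_measure by simp
qed

text \<open>The factor \<open>250 = 25 * 10\<close> comes from \<open>(h j)\<^sup>2 \<ge> 1/25\<close>, which fails with probability at
  most \<open>1/5\<close>, and a Markov bound of \<open>1/10\<close>. The \<open>h i\<close> need not be independent.\<close>

lemma (in prob_space) gaussian_quadratic_form_negative: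
  fixes w :: "nat \<Rightarrow> real"
  assumes h: "\<And>i. i < d \<Longrightarrow> distributed M lborel (h i) std_normal_density"
    and j: "j < d" and w: "250 * (\<Sum>i | i < d \<and> 0 < w i. w i) < - w j"
  shows "prob {x \<in> space M. (\<Sum>i<d. w i * (h i x)\<^sup>2) < 0} \<ge> 2 / 3"
proof -
  define P where "P = {i. i < d \<and> 0 < w i}"
  define X where "X = (\<lambda>x. \<Sum>i\<in>P. w i * (h i x)\<^sup>2)"
  \<comment> \<open>When \<open>\<bar>h j x\<bar> \<ge> 1 / 5\<close>, the term of \<open>j\<close>
    is at most \<open>- c\<close>, so it suffices that the positive terms sum to less than
    \<open>c\<close>.\<close>
  define c where "c = - w j / 25"
  have [measurable]: "h i \<in> borel_measurable M" if "i < d" for i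
    using h[OF that] by (auto simp: distributed_def)
  have sumP: "(\<Sum>i\<in>P. w i) \<ge> 0" by (intro sum_nonneg) (auto simp: P_def)
  hence wj: "w j < 0" using w by (simp add: P_def)
  hence c: "c > 0" by (simp add: c_def)
  have int: "integrable M (\<lambda>x. w i * (h i x)\<^sup>2)" if "i \<in> P" for i
    using standard_normal_second_moment(1)[OF h] that by (simp add: P_def)
  have intX: "integrable M X" unfolding X_def using int by (intro Bochner_Integration.integrable_sum)
  have [measurable]: "X \<in> borel_measurable M" using intX by auto
  have "expectation X = (\<Sum>i\<in>P. w i)"
    unfolding X_def using int standard_normal_second_moment(2)[OF h]
    by (subst Bochner_Integration.integral_sum) (auto simp: P_def intro!: sum.cong)
  moreover have "X x \<ge> 0" for x
    unfolding X_def by (intro sum_nonneg) (auto simp: P_def)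
  ultimately have "prob {x \<in> space M. X x \<ge> c} \<le> (\<Sum>i\<in>P. w i) / c"
    using integral_Markov_inequality_measure[OF intX, of "{}" c] c by simp
  also have "\<dots> \<le> 1 / 10" using w wj by (simp add: c_def P_def field_simps)
  finally have p1: "prob {x \<in> space M. X x \<ge> c} \<le> 1 / 10" .
  have p2: "prob {x \<in> space M. \<bar>h j x\<bar> < 1 / 5} \<le> 1 / 5"
    by (rule standard_normal_anticoncentration[OF h[OF j]]) simp
  let ?bad = "{x \<in> space M. X x \<ge> c} \<union> {x \<in> space M. \<bar>h j x\<bar> < 1 / 5}"
  \<comment> \<open>The total \<open>3 / 10\<close> is below the permitted
    \<open>1 / 3\<close>.\<close>
  have "prob ?bad \<le> 1 / 10 + 1 / 5"
    using measure_Un_le[of "{x \<in> space M. X x \<ge> c}" M "{x \<in> space M. \<bar>h j x\<bar> < 1 / 5}"]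
      p1 p2 j by simp
  moreover have "prob (space M - ?bad) = 1 - prob ?bad"
    using j by (intro prob_compl) measurable
  moreover have "prob (space M - ?bad) \<le> prob {x \<in> space M. (\<Sum>i<d. w i * (h i x)\<^sup>2) < 0}"
  proof (intro finite_measure_mono subsetI)
    fix x assume x: "x \<in> space M - ?bad"
    hence "X x < c" "\<bar>h j x\<bar> \<ge> 1 / 5" by auto
    have "(1 / 5)\<^sup>2 \<le> \<bar>h j x\<bar>\<^sup>2" using \<open>\<bar>h j x\<bar> \<ge> 1 / 5\<close> by (intro power_mono) auto
    hence "w j * (h j x)\<^sup>2 \<le> w j * (1 / 25)"
      using wj by (intro mult_left_mono_neg) (auto simp: power2_eq_square)
    hence "w j * (h j x)\<^sup>2 \<le> - c" by (simp add: c_def)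
    moreover have "(\<Sum>i<d. w i * (h i x)\<^sup>2) = X x + (\<Sum>i\<in>{..<d} - P. w i * (h i x)\<^sup>2)"
      unfolding X_def by (subst sum.subset_diff[of P]) (auto simp: P_def)
    moreover have "(\<Sum>i\<in>{..<d} - P. w i * (h i x)\<^sup>2)
        = w j * (h j x)\<^sup>2 + (\<Sum>i\<in>{..<d} - P - {j}. w i * (h i x)\<^sup>2)"
      using j wj by (intro sum.remove) (auto simp: P_def)
    moreover have "(\<Sum>i\<in>{..<d} - P - {j}. w i * (h i x)\<^sup>2) \<le> 0"
      by (intro sum_nonpos) (auto simp: P_def mult_le_0_iff)
    ultimately show "x \<in> {x \<in> space M. (\<Sum>i<d. w i * (h i x)\<^sup>2) < 0}"
      using x \<open>X x < c\<close> by auto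
  qed measurable
  ultimately show ?thesis by simp
qed

text \<open>By continuity it is enough to let the coefficients range over the rationals, which turns the
  set into a countable union.\<close>

lemma sets_exists_negative_quadratic:
  fixes l :: "nat \<Rightarrow> real"
  assumes [measurable]: "\<And>i. i < d \<Longrightarrow> h i \<in> borel_measurable M"
  shows "{x \<in> space M. \<exists>a :: nat \<Rightarrow> real.
    (\<Sum>i<d. l i * (\<Sum>m\<le>k. a m * l i ^ m)\<^sup>2 * (h i x)\<^sup>2) < 0} \<in> sets M"
proof -
  define F where "F = (\<lambda>a x. \<Sum>i<d. l i * (\<Sum>m\<le>k. a m * l i ^ m)\<^sup>2 * (h i x)\<^sup>2)"
  \<comment> \<open>Only the coefficients up to \<open>k\<close> matter; fixing the values elsewhere
    makes this set of functions countable.\<close>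
  define R where "R = ({..k} \<rightarrow>\<^sub>E \<rat> :: (nat \<Rightarrow> real) set)"
  have "countable R" unfolding R_def by (intro countable_PiE) (auto simp: countable_rat)
  have "(\<exists>a. F a x < 0) \<longleftrightarrow> (\<exists>a\<in>R. F a x < 0)" for x
  proof
    assume "\<exists>a. F a x < 0"
    then obtain a where a: "F a x < 0" by blast
    have "\<exists>r. (\<forall>n. r n \<in> \<rat>) \<and> r \<longlonglongrightarrow> a m" for m
    proof -
      have "\<exists>q\<in>\<rat>. a m < q \<and> q < a m + 1 / real (Suc n)" for n
        by (rule Rats_dense_in_real) simp
      then obtain r where r: "\<And>n. r n \<in> \<rat> \<and> a m < r n \<and> r n < a m + 1 / real (Suc n)"
        by metis
      have "(\<lambda>n. a m + 1 / real (Suc n)) \<longlonglongrightarrow> a m + 0"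
        by (intro tendsto_intros LIMSEQ_Suc[OF lim_1_over_n])
      hence "r \<longlonglongrightarrow> a m"
        by (intro tendsto_sandwich[of "\<lambda>_. a m" r _ "\<lambda>n. a m + 1 / real (Suc n)"])
           (use r in \<open>auto intro!: always_eventually less_imp_le\<close>)
      thus ?thesis using r by blast
    qed
    then obtain r where r: "\<And>m n. r m n \<in> \<rat>" "\<And>m. r m \<longlonglongrightarrow> a m" by metis
    define b where "b = (\<lambda>n. restrict (\<lambda>m. r m n) {..k})"
    have "(\<lambda>n. F (\<lambda>m. r m n) x) \<longlonglongrightarrow> F a x"
      unfolding F_def by (intro tendsto_intros r)
    moreover have "F (\<lambda>m. r m n) x = F (b n) x" for n
      unfolding F_def b_def by simp
    ultimately have "(\<lambda>n. F (b n) x) \<longlonglongrightarrow> F a x" by simp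
    from order_tendstoD(2)[OF this a] obtain n where "F (b n) x < 0"
      by (auto simp: eventually_sequentially)
    moreover have "b n \<in> R" unfolding b_def R_def using r(1) by auto
    ultimately show "\<exists>a\<in>R. F a x < 0" by blast
  qed blast
  hence "{x \<in> space M. \<exists>a. F a x < 0} = (\<Union>a\<in>R. {x \<in> space M. F a x < 0})" by auto
  also have "\<dots> \<in> sets M"
    using \<open>countable R\<close> unfolding F_def by (intro sets.countable_UN') auto
  finally show ?thesis unfolding F_def .
qed

subsection \<open>The theorem\<close>

theorem theorem17:
  shows "\<exists>C::real. C > 0 \<and>
    (\<forall>(d::nat) (p::ereal) (\<epsilon>::real) (A::real mat) (lmin::real) (k::nat).
      2 \<le> d \<longrightarrow> 1 \<le> p \<longrightarrow> 0 < \<epsilon> \<longrightarrow> \<epsilon> \<le> 1 / 2 \<longrightarrow>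
      A \<in> carrier_mat d d \<longrightarrow> transpose_mat A = A \<longrightarrow> A \<noteq> 0\<^sub>m d d \<longrightarrow>
      eigenvalue A lmin \<longrightarrow> lmin \<le> - \<epsilon> * schatten_norm p A \<longrightarrow>
      (p = 1 \<and> real k \<ge> C * (1 / \<epsilon>) powr (1 / 3) * ln (1 / \<epsilon>) \<or>
       p > 1 \<and> real k \<ge> C * (1 / \<epsilon>) powr krylov_exponent p * ln (1 / \<epsilon>) * ln (real d)) \<longrightarrow>
      measure (std_gaussian d)
        {g \<in> space (std_gaussian d).
          \<exists>v \<in> krylov A (vec d g) k. scalar_prod v (A *\<^sub>v v) < 0} \<ge> 2 / 3)"
\<comment> \<open>The constant 16 is the one required by the filter polynomial; it serves both
  ranges of \<open>p\<close>.\<close>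
proof (intro exI[of _ "16 :: real"] conjI allI impI)
  fix d :: nat and p :: ereal and \<epsilon> :: real and A :: "real mat" and lmin :: real and k :: nat
  assume d: "2 \<le> d" and p: "1 \<le> p" and \<epsilon>: "0 < \<epsilon>" "\<epsilon> \<le> 1 / 2"
    and symmetric: "A \<in> carrier_mat d d" "transpose_mat A = A" and nonzero: "A \<noteq> 0\<^sub>m d d"
    and lmin: "eigenvalue A lmin" "lmin \<le> - \<epsilon> * schatten_norm p A"
    and k: "p = 1 \<and> real k \<ge> 16 * (1 / \<epsilon>) powr (1 / 3) * ln (1 / \<epsilon>) \<or>
       p > 1 \<and> real k \<ge> 16 * (1 / \<epsilon>) powr krylov_exponent p * ln (1 / \<epsilon>) * ln (real d)"
  obtain U l where "orthogonal_diagonalization A U l d"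
    using orthogonal_diagonalization_exists[OF symmetric] by blast
  then interpret orthogonal_diagonalization A U l d .
  interpret G: prob_space "std_gaussian d" by (rule prob_space_std_gaussian)
  have d0: "d > 0" using d by simp
  note N = schatten_norm_bounds[OF d0 p nonzero]
  obtain j where j: "j < d" "l j = lmin" using eigenvalue_index[OF lmin(1)] by blast
  obtain q where q: "degree q \<le> k"
    "250 * (\<Sum>i | i < d \<and> 0 < l i. l i * (poly q (l i))\<^sup>2) < - l j * (poly q (l j))\<^sup>2"
    using krylov_filter_poly_exists_scaled[OF d p \<epsilon> N(1) _ _ _ k, where l = l and j = j] N(2,3) lmin(2) j by auto
  \<comment> \<open>\<open>h i g\<close> is the coordinate of the Gaussian vector along
    \<open>col U i\<close>, standard normal because the column is a unit vector.\<close>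
  define h where "h = (\<lambda>i g. \<Sum>m<d. U $$ (m,i) * g m :: real)"
  define w where "w = (\<lambda>i. l i * (poly q (l i))\<^sup>2)"
  have h_col: "col U i \<bullet> vec d g = h i g" if "i < d" for i g
    using that U by (simp add: h_def scalar_prod_def lessThan_atLeast0)
  have h_normal: "distributed (std_gaussian d) lborel (h i) std_normal_density" if "i < d" for i
    unfolding h_def using norm_col[OF that] by (rule std_gaussian_linear_form)
  have h_measurable: "h i \<in> borel_measurable (std_gaussian d)" if "i < d" for i
    using h_normal[OF that] by (auto simp: distributed_def)
  let ?K = "{g \<in> space (std_gaussian d). \<exists>v \<in> krylov A (vec d g) k. v \<bullet> (A *\<^sub>v v) < 0}"
  let ?Q = "\<lambda>a g. \<Sum>i<d. l i * (\<Sum>m\<le>k. a m * l i ^ m)\<^sup>2 * (h i g)\<^sup>2"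
  have K: "?K = {g \<in> space (std_gaussian d). \<exists>a. ?Q a g < 0}"
  proof -
    have "(\<Sum>i<d. l i * (\<Sum>m\<le>k. a m * l i ^ m)\<^sup>2 * (col U i \<bullet> vec d g)\<^sup>2) = ?Q a g" for a g
      by (intro sum.cong refl) (simp add: h_col)
    thus ?thesis using krylov_negative_iff[of "vec d _" k] by simp
  qed
  \<comment> \<open>A positive \<open>w i\<close> forces \<open>l i > 0\<close>, so the filter bound
    transfers to the weights.\<close>
  have "(\<Sum>i | i < d \<and> 0 < w i. w i) \<le> (\<Sum>i | i < d \<and> 0 < l i. w i)"
    by (intro sum_mono2) (auto simp: w_def zero_less_mult_iff)
  hence "250 * (\<Sum>i | i < d \<and> 0 < w i. w i) < - w j"
    using q(2) by (simp add: w_def)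
  hence "2 / 3 \<le> G.prob {g \<in> space (std_gaussian d). (\<Sum>i<d. w i * (h i g)\<^sup>2) < 0}"
    by (intro G.gaussian_quadratic_form_negative[OF h_normal j(1)])
  \<comment> \<open>The coefficients of \<open>q\<close> witness membership in \<open>?K\<close>.
    Monotonicity needs \<open>?K\<close> to be measurable, since \<open>measure\<close> is 0 by
    default on other sets.\<close>
  also have "\<dots> \<le> G.prob ?K"
  proof (rule G.finite_measure_mono)
    have "poly q x = (\<Sum>m\<le>k. coeff q m * x ^ m)" for x
      unfolding poly_altdef using q(1)
      by (intro sum.mono_neutral_left) (auto simp: coeff_eq_0)
    hence "(\<Sum>i<d. w i * (h i g)\<^sup>2) = ?Q (coeff q) g" for g by (simp add: w_def)
    thus "{g \<in> space (std_gaussian d). (\<Sum>i<d. w i * (h i g)\<^sup>2) < 0} \<subseteq> ?K"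
      unfolding K by auto
    show "?K \<in> sets (std_gaussian d)"
      unfolding K by (rule sets_exists_negative_quadratic[OF h_measurable])
  qed
  finally show "measure (std_gaussian d) ?K \<ge> 2 / 3" .
qed simp

end
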